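(* Let $k\in[K]$ and $\mathbf{x}\in\mathcal{X}$. Let $$\ell^*=\min\{\ell\in[L_k+1]: x_{i_{k,\ell}}=1\},$$ and define $\boldsymbol{\delta}\in\mathbb{R}^{L_k+1}$ by $\delta_\ell=r_{i_{k,\ell^*}}$ for $\ell\in\{1,\ldots,\ell^*\}$ and $\delta_\ell=\bar r_k$ for $\ell\in\{\ell^*+1,\ldots,L_k+1\}$. Then $\boldsymbol{\delta}$ is an optimal solution of the problem $$\begin{aligned}\min_{\boldsymbol{\delta}\in\mathbb{R}^{L_k+1}}\quad & \delta_{L_k+1}+\sum_{\ell=1}^{L_k}\left(\max\{0,r_{i_{k,\ell}}-\delta_\ell\}-(\delta_{\ell+1}-\delta_\ell)\right)x_{i_{k,\ell}}\\ \text{subject to}\quad & 0\le\delta_1\le\cdots\le\delta_{L_k+1}\le\bar r_k.\end{aligned}$$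
   Context: Notation: $[n]=\{1,\ldots,n\}$. There are products $[N+1]$, where product $N+1$ is the no-purchase option, with revenues $r_1,\ldots,r_N>0$ and $r_{N+1}=0$. There are $K$ rankings; for each $k\in[K]$, $i_{k,1},\ldots,i_{k,N+1}$ is a permutation of $[N+1]$ listing the products from most to least preferred by ranking $k$. $L_k$ is the number of products preferred to the no-purchase option by ranking $k$, so $i_{k,L_k+1}=N+1$; it is assumed that $L_k\ge1$ for all $k$. Let $\mathcal{X}=\{\mathbf{x}\in\{0,1\}^{N+1}: x_{N+1}=1\}$ and $\bar r_k=\max\{r_{i_{k,\ell}}:\ell\in\{1,\ldots,L_k+1\}\}$. *)

theory Defs
  imports Complex_Main "HOL-Library.FuncSet"
begin

text \<open>
  Products are the numbers \<open>1, \<dots>, N + 1\<close>, where \<open>N + 1\<close> is the no-purchase option. A ranking is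
  a function \<open>\<sigma>\<close> such that \<open>\<sigma> l\<close> is the \<open>l\<close>-th most preferred product, for \<open>l\<close> in
  \<open>{1..N + 1}\<close>; its values outside this range are irrelevant. A vector with coordinates
  \<open>1, \<dots>, n\<close> is a function that is \<open>undefined\<close> outside \<open>{1..n}\<close>.
\<close>

definition preferred :: "nat \<Rightarrow> (nat \<Rightarrow> nat) \<Rightarrow> nat \<Rightarrow> nat \<Rightarrow> bool" where
  "preferred N \<sigma> a b \<longleftrightarrow>
     (\<exists>l\<in>{1..N + 1}. \<exists>m\<in>{1..N + 1}. l < m \<and> \<sigma> l = a \<and> \<sigma> m = b)"

definition num_preferred :: "nat \<Rightarrow> (nat \<Rightarrow> nat) \<Rightarrow> nat" where
  "num_preferred N \<sigma> = card {j \<in> {1..N + 1}. preferred N \<sigma> j (N + 1)}"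

definition assortments :: "nat \<Rightarrow> (nat \<Rightarrow> real) set" where
  "assortments N = {x \<in> {1..N + 1} \<rightarrow>\<^sub>E {0, 1}. x (N + 1) = 1}"

definition max_revenue :: "nat \<Rightarrow> (nat \<Rightarrow> real) \<Rightarrow> (nat \<Rightarrow> nat) \<Rightarrow> real" where
  "max_revenue N r \<sigma> = Max ((\<lambda>l. r (\<sigma> l)) ` {1..num_preferred N \<sigma> + 1})"

definition first_available :: "nat \<Rightarrow> (nat \<Rightarrow> nat) \<Rightarrow> (nat \<Rightarrow> real) \<Rightarrow> nat" where
  "first_available N \<sigma> x = Min {l \<in> {1..num_preferred N \<sigma> + 1}. x (\<sigma> l) = 1}"

definition feasible ::
    "nat \<Rightarrow> (nat \<Rightarrow> real) \<Rightarrow> (nat \<Rightarrow> nat) \<Rightarrow> (nat \<Rightarrow> real) \<Rightarrow> bool" where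
  "feasible N r \<sigma> \<delta> \<longleftrightarrow>
     (let L = num_preferred N \<sigma> in
        \<delta> \<in> {1..L + 1} \<rightarrow>\<^sub>E UNIV \<and>
        0 \<le> \<delta> 1 \<and> (\<forall>l\<in>{1..L}. \<delta> l \<le> \<delta> (l + 1)) \<and> \<delta> (L + 1) \<le> max_revenue N r \<sigma>)"

definition objective ::
    "nat \<Rightarrow> (nat \<Rightarrow> real) \<Rightarrow> (nat \<Rightarrow> nat) \<Rightarrow> (nat \<Rightarrow> real) \<Rightarrow> (nat \<Rightarrow> real) \<Rightarrow> real" where
  "objective N r \<sigma> x \<delta> =
     (let L = num_preferred N \<sigma> in
        \<delta> (L + 1) +
        (\<Sum>l = 1..L. (max 0 (r (\<sigma> l) - \<delta> l) - (\<delta> (l + 1) - \<delta> l)) * x (\<sigma> l)))"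

definition candidate ::
    "nat \<Rightarrow> (nat \<Rightarrow> real) \<Rightarrow> (nat \<Rightarrow> nat) \<Rightarrow> (nat \<Rightarrow> real) \<Rightarrow> nat \<Rightarrow> real" where
  "candidate N r \<sigma> x =
     (let l' = first_available N \<sigma> x in
        (\<lambda>l\<in>{1..num_preferred N \<sigma> + 1}. if l \<le> l' then r (\<sigma> l') else max_revenue N r \<sigma>))"

end

theory Submission imports Defs begin

text \<open>
  The objective is a telescoping sum in disguise. Let \<open>s\<close> be the position of the first available
  product of the ranking. The terms before \<open>s\<close> vanish, and from \<open>s\<close> on the objective pays for the
  terminal value \<open>\<delta> (L + 1)\<close> but gets back the increments of \<open>\<delta>\<close> at the available positions. The
  increments are nonnegative, so at best all of them from \<open>s\<close> on are returned, which leaves \<open>\<delta> s\<close>;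
  the hinge term at \<open>s\<close> adds at least \<open>r (\<sigma> s) - \<delta> s\<close>. Every feasible \<open>\<delta>\<close> therefore costs at
  least \<open>r (\<sigma> s)\<close>, the revenue of the product that is actually bought
  (\<open>revenue_le_ranking_cost\<close>).

  The candidate loses nothing in these estimates: its only increment is at the available position
  \<open>s\<close>, its hinge term at \<open>s\<close> is zero, and the later hinge terms are zero because it then equals
  the maximal revenue (\<open>ranking_cost_step\<close>).

  If nothing is available before the no-purchase option, then \<open>s = L + 1\<close>, the sum is zero and
  the objective is \<open>\<delta> (L + 1) \<ge> 0\<close>. Here the argument rests on \<open>\<sigma> (L + 1) = N + 1\<close>
  (\<open>no_purchase_position\<close>), so that the candidate ends in the revenue \<open>0\<close> of the no-purchase
  option.
\<close>

text \<open>
  A product is preferred to \<open>N + 1\<close> exactly if its position precedes that of \<open>N + 1\<close>, so counting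
  such products recovers the position.
\<close>

lemma no_purchase_position:
  assumes bij: "bij_betw \<sigma> {1..N + 1} {1..N + 1}"
  shows "\<sigma> (num_preferred N \<sigma> + 1) = N + 1" and "num_preferred N \<sigma> \<le> N"
proof -
  have "N + 1 \<in> \<sigma> ` {1..N + 1}"
    using bij by (simp add: bij_betw_def)
  then obtain m where m: "m \<in> {1..N + 1}" "\<sigma> m = N + 1" by auto
  have inj: "inj_on \<sigma> {1..N + 1}"
    using bij by (rule bij_betw_imp_inj_on)
  have "{j \<in> {1..N + 1}. preferred N \<sigma> j (N + 1)} = \<sigma> ` {1..<m}"
  proof (intro equalityI subsetI)
    fix j assume "j \<in> {j \<in> {1..N + 1}. preferred N \<sigma> j (N + 1)}"
    then obtain l m' where "l \<in> {1..N + 1}" "m' \<in> {1..N + 1}" "l < m'" "\<sigma> l = j" "\<sigma> m' = N + 1"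
      unfolding preferred_def by auto
    moreover from this have "m' = m" using m inj by (metis inj_onD)
    ultimately show "j \<in> \<sigma> ` {1..<m}" by auto
  next
    fix j assume "j \<in> \<sigma> ` {1..<m}"
    then obtain l where l: "1 \<le> l" "l < m" "\<sigma> l = j" by auto
    then have "l \<in> {1..N + 1}" using m by auto
    then have "preferred N \<sigma> j (N + 1)"
      using l m unfolding preferred_def by blast
    moreover have "j \<in> {1..N + 1}"
      using \<open>l \<in> {1..N + 1}\<close> l bij_betwE[OF bij] by blast
    ultimately show "j \<in> {j \<in> {1..N + 1}. preferred N \<sigma> j (N + 1)}" by simp
  qed
  moreover have "inj_on \<sigma> {1..<m}"
    by (rule inj_on_subset[OF inj]) (use m in auto)
  ultimately have "num_preferred N \<sigma> = m - 1"
    by (simp add: num_preferred_def card_image)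
  then show "\<sigma> (num_preferred N \<sigma> + 1) = N + 1" "num_preferred N \<sigma> \<le> N"
    using m by auto
qed

text \<open>
  The objective in terms of the revenues \<open>p\<close> and the availabilities \<open>y\<close> by position; the
  permutation matters only through these two sequences.
\<close>

definition ranking_cost ::
    "nat \<Rightarrow> (nat \<Rightarrow> real) \<Rightarrow> (nat \<Rightarrow> real) \<Rightarrow> (nat \<Rightarrow> real) \<Rightarrow> real" where
  "ranking_cost L p y \<delta> =
     \<delta> (L + 1) + (\<Sum>l = 1..L. (max 0 (p l - \<delta> l) - (\<delta> (l + 1) - \<delta> l)) * y l)"

lemma objective_eq_ranking_cost:
  "objective N r \<sigma> x \<delta> = ranking_cost (num_preferred N \<sigma>) (\<lambda>l. r (\<sigma> l)) (\<lambda>l. x (\<sigma> l)) \<delta>"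
  by (simp add: objective_def ranking_cost_def Let_def)

lemma ranking_cost_drop_unavailable:
  assumes "1 \<le> s" and "\<And>l. 1 \<le> l \<Longrightarrow> l < s \<Longrightarrow> y l = 0"
  shows "ranking_cost L p y \<delta> =
    \<delta> (L + 1) + (\<Sum>l = s..L. (max 0 (p l - \<delta> l) - (\<delta> (l + 1) - \<delta> l)) * y l)"
  unfolding ranking_cost_def
  by (intro arg_cong2[where f = "(+)"] refl sum.mono_neutral_right) (use assms in auto)

text \<open>
  Each increment from \<open>s\<close> on is returned at most once, so what is left of \<open>\<delta> (L + 1)\<close> is at least
  \<open>\<delta> s\<close>, and the hinge term at \<open>s\<close> lifts this to \<open>p s\<close>.
\<close>

lemma revenue_le_ranking_cost:
  assumes s: "1 \<le> s" "s \<le> L" "y s = 1"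
    and before: "\<And>l. 1 \<le> l \<Longrightarrow> l < s \<Longrightarrow> y l = 0"
    and y: "\<And>l. s \<le> l \<Longrightarrow> l \<le> L \<Longrightarrow> 0 \<le> y l \<and> y l \<le> 1"
    and mono: "\<And>l. s \<le> l \<Longrightarrow> l \<le> L \<Longrightarrow> \<delta> l \<le> \<delta> (l + 1)"
  shows "p s \<le> ranking_cost L p y \<delta>"
proof -
  have "(if l = s then p s - \<delta> s else 0) - (\<delta> (l + 1) - \<delta> l)
      \<le> (max 0 (p l - \<delta> l) - (\<delta> (l + 1) - \<delta> l)) * y l" if l: "l \<in> {s..L}" for l
  proof (cases "l = s")
    case True
    then show ?thesis using s by simp
  next
    case False
    have "0 \<le> max 0 (p l - \<delta> l) * y l" using y[of l] l by simp
    moreover have "(\<delta> (l + 1) - \<delta> l) * y l \<le> \<delta> (l + 1) - \<delta> l"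
      using y[of l] mono[of l] l by (intro mult_left_le) auto
    ultimately show ?thesis using False by (simp add: left_diff_distrib)
  qed
  then have "(\<Sum>l = s..L. (if l = s then p s - \<delta> s else 0) - (\<delta> (l + 1) - \<delta> l))
      \<le> (\<Sum>l = s..L. (max 0 (p l - \<delta> l) - (\<delta> (l + 1) - \<delta> l)) * y l)"
    by (rule sum_mono)
  moreover have "(\<Sum>l = s..L. \<delta> (l + 1) - \<delta> l) = \<delta> (L + 1) - \<delta> s"
    using sum_Suc_diff[of s L \<delta>] s by simp
  ultimately show ?thesis
    using s ranking_cost_drop_unavailable[OF s(1) before, where L = L and p = p and \<delta> = \<delta>]
    by (simp add: sum_subtractf sum.delta)
qed

text \<open>
  A step that jumps at \<open>s\<close> to an upper bound \<open>M\<close> of the later revenues attains the bound: the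
  jump \<open>M - p s\<close> is returned in full at \<open>s\<close>, and all other terms of the sum vanish.
\<close>

lemma ranking_cost_step:
  assumes s: "1 \<le> s" "s \<le> L" "y s = 1"
    and before: "\<And>l. 1 \<le> l \<Longrightarrow> l < s \<Longrightarrow> y l = 0"
    and M: "\<And>l. s < l \<Longrightarrow> l \<le> L \<Longrightarrow> p l \<le> M"
    and \<delta>: "\<delta> s = p s" "\<And>l. s < l \<Longrightarrow> l \<le> L + 1 \<Longrightarrow> \<delta> l = M"
  shows "ranking_cost L p y \<delta> = p s"
proof -
  have "(\<Sum>l = s..L. (max 0 (p l - \<delta> l) - (\<delta> (l + 1) - \<delta> l)) * y l)
      = (\<Sum>l = s..L. if l = s then p s - M else 0)"
    using s \<delta> M by (intro sum.cong) auto
  then show ?thesis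
    using s \<delta>(2)[of "L + 1"] ranking_cost_drop_unavailable[OF s(1) before, where L = L and p = p and \<delta> = \<delta>]
    by (simp add: sum.delta)
qed

theorem proposition2:
  fixes N K k :: nat and r :: "nat \<Rightarrow> real" and i :: "nat \<Rightarrow> nat \<Rightarrow> nat"
    and x :: "nat \<Rightarrow> real"
  assumes "\<forall>j\<in>{1..N}. r j > 0" and "r (N + 1) = 0"
    and "\<forall>k'\<in>{1..K}. bij_betw (i k') {1..N + 1} {1..N + 1}"
    and "\<forall>k'\<in>{1..K}. num_preferred N (i k') \<ge> 1"
    and "k \<in> {1..K}" and "x \<in> assortments N"
  shows "is_arg_min (objective N r (i k) x) (feasible N r (i k)) (candidate N r (i k) x)"
proof -
  define \<sigma> where "\<sigma> = i k"
  define L where "L = num_preferred N \<sigma>"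
  define s where "s = first_available N \<sigma> x"
  define M where "M = max_revenue N r \<sigma>"
  define c where "c = candidate N r \<sigma> x"
  define p where "p l = r (\<sigma> l)" for l
  define y where "y l = x (\<sigma> l)" for l
  have bij: "bij_betw \<sigma> {1..N + 1} {1..N + 1}"
    using assms(3,5) by (simp add: \<sigma>_def)
  have last: "\<sigma> (L + 1) = N + 1" and LN: "L \<le> N"
    using no_purchase_position[OF bij] by (auto simp: L_def)
  have \<sigma>: "\<sigma> l \<in> {1..N + 1}" if "l \<in> {1..L + 1}" for l
    using bij_betwE[OF bij] that LN by auto
  have y01: "y l = 0 \<or> y l = 1" if "l \<in> {1..L + 1}" for l
    using assms(6) \<sigma>[OF that] unfolding assortments_def y_def by auto
  have p0: "0 \<le> p l" if "l \<in> {1..L + 1}" for l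
  proof (cases "\<sigma> l = N + 1")
    case True
    then show ?thesis using assms(2) by (simp add: p_def)
  next
    case False
    then have "\<sigma> l \<in> {1..N}" using \<sigma>[OF that] by auto
    then show ?thesis using assms(1) by (auto simp: p_def intro: less_imp_le)
  qed
  have pM: "p l \<le> M" if "l \<in> {1..L + 1}" for l
    unfolding M_def max_revenue_def p_def using that by (intro Max_ge) (auto simp: L_def)

  \<comment> \<open>The no-purchase option is always available, so the minimum ranges over a nonempty set.\<close>
  define A where "A = {l \<in> {1..L + 1}. y l = 1}"
  have s_Min: "s = Min A"
    by (simp add: s_def first_available_def A_def L_def y_def)
  have "L + 1 \<in> A"
    using assms(6) last by (simp add: A_def y_def assortments_def)
  then have "s \<in> A" unfolding s_Min by (intro Min_in) (auto simp: A_def)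
  then have s: "1 \<le> s" "s \<le> L + 1" "y s = 1" by (auto simp: A_def)
  have before: "y l = 0" if "1 \<le> l" "l < s" for l
  proof -
    have "finite A" by (simp add: A_def)
    then have "l \<notin> A" using that(2) Min_le[of A l] s_Min by linarith
    then show ?thesis using y01[of l] that s by (auto simp: A_def)
  qed

  have c: "c l = (if l \<le> s then p s else M)" if "l \<in> {1..L + 1}" for l
    using that unfolding c_def candidate_def s_def L_def M_def p_def Let_def by simp
  have feas_c: "feasible N r \<sigma> c"
  proof -
    have "c \<in> {1..L + 1} \<rightarrow>\<^sub>E UNIV"
      unfolding c_def candidate_def Let_def L_def by auto
    moreover have "0 \<le> c 1" "c (L + 1) \<le> M" "\<forall>l\<in>{1..L}. c l \<le> c (l + 1)"
      using s p0[of s] pM[of s] by (auto simp: c)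
    ultimately show ?thesis by (simp add: feasible_def L_def M_def)
  qed
  have obj: "objective N r \<sigma> x \<delta> = ranking_cost L p y \<delta>" for \<delta>
    unfolding objective_eq_ranking_cost L_def p_def y_def ..

  have opt: "objective N r \<sigma> x c \<le> objective N r \<sigma> x \<delta>" if feas: "feasible N r \<sigma> \<delta>" for \<delta>
  proof -
    have mono: "\<delta> l \<le> \<delta> (l + 1)" if "1 \<le> l" "l \<le> L" for l
      using feas that by (simp add: feasible_def L_def Let_def)
    show ?thesis
    proof (cases "s = L + 1")
      case True
      have nonneg: "0 \<le> \<delta> l" if "1 \<le> l" "l \<le> L + 1" for l
        using that
      proof (induction l rule: dec_induct)
        case base
        then show ?case using feas by (simp add: feasible_def Let_def)
      next
        case (step n)
        then show ?case using mono[of n] by simp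
      qed
      have "ranking_cost L p y \<delta>' = \<delta>' (L + 1)" for \<delta>'
        using ranking_cost_drop_unavailable[where y = y, OF s(1) before] True by simp
      moreover have "c (L + 1) = 0"
        using True last assms(2) by (simp add: c p_def)
      ultimately show ?thesis using nonneg[of "L + 1"] by (simp add: obj)
    next
      case False
      then have sL: "s \<le> L" using s by simp
      have "ranking_cost L p y c = p s"
        by (rule ranking_cost_step[where M = M and y = y, OF s(1) sL s(3) before]) (use s pM c in auto)
      moreover have "p s \<le> ranking_cost L p y \<delta>"
      proof (rule revenue_le_ranking_cost[where y = y, OF s(1) sL s(3) before])
        show "0 \<le> y l \<and> y l \<le> 1" if "s \<le> l" "l \<le> L" for l
          using y01[of l] that s by auto
        show "\<delta> l \<le> \<delta> (l + 1)" if "s \<le> l" "l \<le> L" for l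
          using mono that s by simp
      qed
      ultimately show ?thesis by (simp add: obj)
    qed
  qed
  have "is_arg_min (objective N r \<sigma> x) (feasible N r \<sigma>) c"
    unfolding is_arg_min_linorder using feas_c opt by blast
  then show ?thesis by (simp add: c_def \<sigma>_def)
qed

end
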